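(* Let $d\ge2$, $\sigma>0$, $P=\mathcal N(0,\sigma^2I_d)$ on $\mathbb{R}^d$, and let $\psi$ be a bounded score function satisfying (i)–(iv) of the context with constants $\beta,\gamma>0$, and such that for $X\sim P$, $\mathbb{E}[\rho(\|X-\mathbb{E}[X]\|)]<\min\left(\rho(\beta/3),\psi(\beta/2)^2/2\right)$. Then there exist a probability distribution $Q$ on $\mathbb{R}^d$ and $\varepsilon_{\max}>0$ such that for all $\varepsilon\in(0,\varepsilon_{\max})$, $$\|T(P)-T(P_\varepsilon)\|=\|T(P_\varepsilon)\|\ge\sigma\frac{\varepsilon\sqrt{d-2}}{12},$$ where $P_\varepsilon=(1-\varepsilon)P+\varepsilon Q$.
   Context: $\|\cdot\|$ is the Euclidean norm on $\mathbb{R}^d$. Score function: $\psi:\mathbb{R}_+\to\mathbb{R}_+$ satisfies (i) $\psi$ is continuous and differentiable almost everywhere; (ii) $\psi(0)=0$; (iii) $\psi$ is concave; (iv) there are $\beta,\gamma>0$ with $1\ge\psi'(x)\ge\gamma\mathbf{1}\{x\le\beta\}$ for all $x\ge 0$. Put $\rho(x)=\int_0^x\psi(t)\,dt$. For a probability distribution $R$ on $\mathbb{R}^d$, $T(R)$ is the (assumed unique) solution of $\mathbb{E}_{X\sim R}\left[\frac{X-T(R)}{\|X-T(R)\|}\psi(\|X-T(R)\|)\right]=0$, with the convention that $\frac{x-\theta}{\|x-\theta\|}\psi(\|x-\theta\|)=0$ when $x=\theta$. *)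

theory Defs
  imports "HOL-Probability.Probability"
begin

(* Only the values of psi on {0..} are constrained. The bounds on the derivative are imposed at
   every point where it exists, so that kinks (as in min x c) are allowed; at 0 the derivative is
   the one-sided one. *)
definition score_function :: "(real \<Rightarrow> real) \<Rightarrow> real \<Rightarrow> real \<Rightarrow> bool" where
  "score_function \<psi> \<beta> \<gamma> \<longleftrightarrow>
     (\<forall>x\<ge>0. 0 \<le> \<psi> x) \<and>
     continuous_on {0..} \<psi> \<and>
     (AE x in lborel. x \<ge> 0 \<longrightarrow> \<psi> differentiable (at x within {0..})) \<and>
     \<psi> 0 = 0 \<and>
     concave_on {0..} \<psi> \<and>
     \<beta> > 0 \<and> \<gamma> > 0 \<and>
     (\<forall>x\<ge>0. \<forall>D. (\<psi> has_real_derivative D) (at x within {0..}) \<longrightarrow>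
        D \<le> 1 \<and> \<gamma> * indicator {..\<beta>} x \<le> D)"

definition rho :: "(real \<Rightarrow> real) \<Rightarrow> real \<Rightarrow> real" where
  "rho \<psi> x = integral {0..x} \<psi>"

definition score_vector :: "(real \<Rightarrow> real) \<Rightarrow> 'a::euclidean_space \<Rightarrow> 'a \<Rightarrow> 'a" where
  "score_vector \<psi> \<theta> x =
     (if x = \<theta> then 0 else \<psi> (norm (x - \<theta>)) *\<^sub>R ((x - \<theta>) /\<^sub>R norm (x - \<theta>)))"

(* Integrability is required explicitly because the Bochner integral of a non-integrable
   function is 0 by convention. *)
definition score_equation ::
  "(real \<Rightarrow> real) \<Rightarrow> 'a::euclidean_space measure \<Rightarrow> 'a \<Rightarrow> bool" where
  "score_equation \<psi> R \<theta> \<longleftrightarrow>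
     integrable R (score_vector \<psi> \<theta>) \<and> (\<integral>x. score_vector \<psi> \<theta> x \<partial>R) = 0"

(* Meaningful only when the score equation has exactly one solution. *)
definition T_functional :: "(real \<Rightarrow> real) \<Rightarrow> 'a::euclidean_space measure \<Rightarrow> 'a" where
  "T_functional \<psi> R = (THE \<theta>. score_equation \<psi> R \<theta>)"

(* The normal distribution with mean \<mu> and covariance \<sigma>^2 times the identity: its coordinates are
   independent with standard deviation \<sigma>. *)
definition isotropic_normal :: "'a::euclidean_space \<Rightarrow> real \<Rightarrow> 'a measure" where
  "isotropic_normal \<mu> \<sigma> =
     density lborel (\<lambda>x. ennreal (\<Prod>b\<in>Basis. normal_density (\<mu> \<bullet> b) \<sigma> (x \<bullet> b)))"

(* The mixture (1 - \<epsilon>) P + \<epsilon> Q, for measures with the same measurable sets. *)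
definition mixture :: "real \<Rightarrow> 'a measure \<Rightarrow> 'a measure \<Rightarrow> 'a measure" where
  "mixture \<epsilon> P Q = measure_of (space P) (sets P)
     (\<lambda>A. ennreal (1 - \<epsilon>) * emeasure P A + ennreal \<epsilon> * emeasure Q A)"

lemma sets_mixture: "sets (mixture \<epsilon> P Q) = sets P"
  by (simp add: mixture_def)

lemma emeasure_mixture:
  assumes "sets Q = sets P" "A \<in> sets P"
  shows "emeasure (mixture \<epsilon> P Q) A =
    ennreal (1 - \<epsilon>) * emeasure P A + ennreal \<epsilon> * emeasure Q A"
  unfolding mixture_def
proof (rule emeasure_measure_of_sigma)
  let ?m = "\<lambda>A. ennreal (1 - \<epsilon>) * emeasure P A + ennreal \<epsilon> * emeasure Q A"
  show "sigma_algebra (space P) (sets P)" ..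
  show "positive (sets P) ?m"
    by (simp add: positive_def)
  show "countably_additive (sets P) ?m"
  proof (rule countably_additiveI)
    fix B :: "nat \<Rightarrow> 'a set"
    assume B: "range B \<subseteq> sets P" "disjoint_family B" "\<Union> (range B) \<in> sets P"
    have "(\<Sum>i. ?m (B i)) =
        ennreal (1 - \<epsilon>) * (\<Sum>i. emeasure P (B i)) + ennreal \<epsilon> * (\<Sum>i. emeasure Q (B i))"
      by (simp add: suminf_add[symmetric])
    then show "(\<Sum>i. ?m (B i)) = ?m (\<Union> (range B))"
      using B assms(1) by (simp add: suminf_emeasure)
  qed
  show "A \<in> sets P" by fact
qed

lemma prob_space_mixture:
  assumes "prob_space P" "prob_space Q" "sets Q = sets P" "0 \<le> \<epsilon>" "\<epsilon> \<le> 1"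
  shows "prob_space (mixture \<epsilon> P Q)"
proof (rule prob_spaceI)
  have sp: "space (mixture \<epsilon> P Q) = space P"
    using sets_eq_imp_space_eq[OF sets_mixture] .
  have sq: "space Q = space P"
    using sets_eq_imp_space_eq[OF assms(3)] .
  have "emeasure (mixture \<epsilon> P Q) (space P) =
      ennreal (1 - \<epsilon>) * emeasure P (space P) + ennreal \<epsilon> * emeasure Q (space P)"
    by (rule emeasure_mixture[OF assms(3) sets.top])
  also have "\<dots> = ennreal (1 - \<epsilon>) + ennreal \<epsilon>"
    using prob_space.emeasure_space_1[OF assms(1)] prob_space.emeasure_space_1[OF assms(2)]
    unfolding sq by (simp only: mult_1_right)
  also have "\<dots> = ennreal (1 - \<epsilon> + \<epsilon>)"
    using assms(4,5) by (intro ennreal_plus[symmetric]) auto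
  finally show "emeasure (mixture \<epsilon> P Q) (space (mixture \<epsilon> P Q)) = 1"
    unfolding sp by simp
qed

end

(* Let s(z) = psi(|z|) z/|z|, let b = sup psi, let F(theta) be the mean of s(X - theta) for X ~ P, and
   let Q be the point mass at some q so far away that psi(|q - theta|) > b/2 whenever |theta| <= 1.

   The field s is monotone, and strictly so at the midpoint of two parameters, so score equations
   have at most one solution under any measure charging all sets of positive Lebesgue measure.
   Since F(0) = 0, strictness and compactness bound <F(theta), theta> away from 0 on the unit sphere,
   so for small epsilon the perturbed field still points inwards and, by Brouwer, vanishes at some
   |theta| <= 1. There (1 - epsilon) |F(theta)| = epsilon psi(|q - theta|) >= epsilon b/2.

   Conversely |s(u) - s(v)| <= 2b |u - v| / |v|, because psi is nondecreasing and psi(r)/r is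
   nonincreasing. Hence |F(theta)| <= 2b |theta| E[1/|X|], where E[1/|X|^2] = 1/(sigma^2 (d - 2)) gives
   E[1/|X|] <= 1/(sigma sqrt(d - 2)). Comparing both bounds yields the claim, with 4 in place of 12. *)
theory Submission
  imports Defs "HOL-Real_Asymp.Real_Asymp"
begin

section \<open>Zeros of inward-pointing vector fields on the ball\<close>

text \<open>Brouwer's theorem is applied to \<open>x + F x\<close> projected back onto the ball. At
  a fixed point, \<open>F x\<close> is an outer normal of the ball at \<open>x\<close>. A nonzero
  one exists only on the sphere and points outwards there, which \<open>inward\<close>
  excludes.\<close>

lemma exists_zero_of_inward_field:
  fixes F :: "'a::euclidean_space \<Rightarrow> 'a"
  assumes cont: "continuous_on (cball 0 1) F"
    and inward: "\<And>x. norm x = 1 \<Longrightarrow> F x \<bullet> x < 0"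
  obtains x where "norm x \<le> 1" "F x = 0"
proof -
  define S where "S = (cball 0 1 :: 'a set)"
  have S: "compact S" "convex S" "S \<noteq> {}" "closed S"
    by (auto simp: S_def)
  let ?f = "\<lambda>x. closest_point S (x + F x)"
  have "continuous_on S ?f"
    by (rule continuous_on_compose2[OF continuous_on_closest_point[OF S(2,4,3), of UNIV]])
      (use cont in \<open>auto simp: S_def intro!: continuous_intros\<close>)
  moreover have "?f \<in> S \<rightarrow> S"
    using closest_point_in_set[OF S(4,3)] by auto
  ultimately obtain x where x: "x \<in> S" "?f x = x"
    using brouwer[OF S(1-3)] by blast
  have angle: "F x \<bullet> (y - x) \<le> 0" if "y \<in> S" for y
    using closest_point_dot[OF S(2,4) that, of "x + F x"] x(2) by simp
  have "F x = 0"
  proof (rule ccontr)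
    assume F: "F x \<noteq> 0"
    \<comment> \<open>The test point is the point of the ball farthest in direction
      \<open>F x\<close>. The resulting bound and Cauchy-Schwarz force \<open>x\<close> onto the
      sphere.\<close>
    have "F x \<bullet> (F x /\<^sub>R norm (F x) - x) \<le> 0"
      by (rule angle) (use F in \<open>simp add: S_def\<close>)
    then have le: "norm (F x) \<le> F x \<bullet> x"
      using F by (simp add: inner_diff_right dot_square_norm power2_eq_square divide_simps)
    also have "\<dots> \<le> norm (F x) * norm x"
      by (rule norm_cauchy_schwarz)
    finally have "norm x = 1"
      using F x(1) by (simp add: S_def)
    from inward[OF this] le show False
      using norm_ge_zero[of "F x"] by linarith
  qed
  with x(1) show thesis
    by (intro that) (auto simp: S_def)
qed

section \<open>Integration against a mixture\<close>

lemma scale_measure_le_mixture: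
  assumes "sets Q = sets P"
  shows "scale_measure (ennreal (1 - \<epsilon>)) P \<le> mixture \<epsilon> P Q"
    and "scale_measure (ennreal \<epsilon>) Q \<le> mixture \<epsilon> P Q"
  by (subst le_measure; force simp: sets_mixture assms emeasure_mixture)+

text \<open>Each component, scaled by its weight, lies below the mixture as a measure. Both weights
  are positive, so finiteness of the integral of the norm survives division by them.\<close>

lemma integrable_of_integrable_mixture:
  fixes f :: "'a \<Rightarrow> 'b::{banach, second_countable_topology}"
  assumes QP: "sets Q = sets P" and \<epsilon>: "0 < \<epsilon>" "\<epsilon> < 1"
    and f: "integrable (mixture \<epsilon> P Q) f"
  shows "integrable P f" "integrable Q f"
proof -
  have meas: "f \<in> borel_measurable P" "f \<in> borel_measurable Q"
    using borel_measurable_integrable[OF f]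
    by (simp_all cong: measurable_cong_sets add: sets_mixture QP)
  have fin: "(\<integral>\<^sup>+x. norm (f x) \<partial>mixture \<epsilon> P Q) < \<infinity>"
    using f by (simp add: integrable_iff_bounded)
  have bound: "(\<integral>\<^sup>+x. norm (f x) \<partial>M) < \<infinity>"
    if "scale_measure (ennreal r) M \<le> mixture \<epsilon> P Q" "r > 0" "sets M = sets P" "f \<in> borel_measurable M" for r M
  proof -
    have "ennreal r * (\<integral>\<^sup>+x. norm (f x) \<partial>M) = (\<integral>\<^sup>+x. norm (f x) \<partial>scale_measure (ennreal r) M)"
      using that(4) by (subst nn_integral_scale_measure) auto
    also have "\<dots> \<le> (\<integral>\<^sup>+x. norm (f x) \<partial>mixture \<epsilon> P Q)"
      by (rule nn_integral_mono_measure[OF _ that(1)]) (simp add: sets_mixture that(3))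
    finally have "ennreal r * (\<integral>\<^sup>+x. norm (f x) \<partial>M) < \<infinity>"
      using fin by (rule le_less_trans)
    then show ?thesis
      using \<open>r > 0\<close> by (auto simp: ennreal_mult_less_top)
  qed
  show "integrable P f" "integrable Q f"
    using bound[OF scale_measure_le_mixture(1)[OF QP]] bound[OF scale_measure_le_mixture(2)[OF QP]]
      meas \<epsilon> QP by (auto simp: integrable_iff_bounded)
qed

lemma integral_mixture:
  fixes f :: "'a \<Rightarrow> 'b::{banach, second_countable_topology}"
  assumes P: "prob_space P" and Q: "prob_space Q" and QP: "sets Q = sets P"
    and \<epsilon>: "0 < \<epsilon>" "\<epsilon> < 1" and f: "integrable (mixture \<epsilon> P Q) f"
  shows "(\<integral>x. f x \<partial>mixture \<epsilon> P Q) = (1 - \<epsilon>) *\<^sub>R (\<integral>x. f x \<partial>P) + \<epsilon> *\<^sub>R (\<integral>x. f x \<partial>Q)"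
  using f
proof induction
  let ?M = "mixture \<epsilon> P Q"
  interpret P: prob_space P by fact
  interpret Q: prob_space Q by fact
  interpret M: prob_space ?M
    by (rule prob_space_mixture[OF P Q QP]) (use \<epsilon> in auto)
  have space: "space ?M = space P" "space Q = space P"
    using sets_eq_imp_space_eq[OF sets_mixture, of \<epsilon> P Q] sets_eq_imp_space_eq[OF QP] by simp_all
  {
    case (base A c)
    then have A: "A \<in> sets P" "A \<in> sets Q" "A \<in> sets ?M"
      by (auto simp: sets_mixture QP)
    have "ennreal (M.prob A) = ennreal ((1 - \<epsilon>) * P.prob A + \<epsilon> * Q.prob A)"
      using emeasure_mixture[OF QP A(1), of \<epsilon>] \<epsilon>
      by (simp add: M.emeasure_eq_measure P.emeasure_eq_measure Q.emeasure_eq_measure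
          ennreal_mult ennreal_plus)
    then have "M.prob A = (1 - \<epsilon>) * P.prob A + \<epsilon> * Q.prob A"
      using \<epsilon> by (subst (asm) ennreal_inj) auto
    then show ?case
      using A by (simp add: scaleR_left_distrib M.emeasure_eq_measure P.emeasure_eq_measure Q.emeasure_eq_measure)
  next
    case (add f g)
    note i = integrable_of_integrable_mixture[OF QP \<epsilon>]
    show ?case
      using add i[OF add(1)] i[OF add(2)] by (simp add: algebra_simps)
  next
    case (lim f s)
    note i = integrable_of_integrable_mixture[OF QP \<epsilon>]
    \<comment> \<open>The induction rule supplies approximants bounded by twice the norm of the
      limit, hence the dominating function. The claim is stated for a general \<open>N\<close> to
      serve \<open>P\<close>, \<open>Q\<close> and the mixture alike.\<close>
    have conv: "(\<lambda>n. \<integral>x. s n x \<partial>N) \<longlonglongrightarrow> (\<integral>x. f x \<partial>N)"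
      if "space N = space P" "integrable N f" "\<And>n. integrable N (s n)" for N
      by (rule integral_dominated_convergence[where w="\<lambda>x. 2 * norm (f x)"])
        (use that lim space in \<open>auto intro!: borel_measurable_integrable\<close>)
    have "(\<lambda>n. \<integral>x. s n x \<partial>?M) \<longlonglongrightarrow> (1 - \<epsilon>) *\<^sub>R (\<integral>x. f x \<partial>P) + \<epsilon> *\<^sub>R (\<integral>x. f x \<partial>Q)"
      unfolding lim.IH
      by (intro tendsto_intros conv) (auto intro: i lim.hyps simp: space)
    moreover have "(\<lambda>n. \<integral>x. s n x \<partial>?M) \<longlonglongrightarrow> (\<integral>x. f x \<partial>?M)"
      by (intro conv) (auto intro: lim.hyps simp: space)
    ultimately show ?case
      by (rule LIMSEQ_unique[rotated])
  }
qed

section \<open>The score field: monotonicity and increments\<close>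

text \<open>A case-free form of \<open>score_vector\<close> with the parameter moved to the origin;
  division by zero yields the conventional value 0 at \<open>z = 0\<close>.\<close>

definition score :: "(real \<Rightarrow> real) \<Rightarrow> 'a::euclidean_space \<Rightarrow> 'a" where
  "score \<psi> z = (\<psi> (norm z) / norm z) *\<^sub>R z"

lemma score_vector_eq_score: "score_vector \<psi> \<theta> x = score \<psi> (x - \<theta>)"
  by (simp add: score_vector_def score_def divide_inverse)

lemma score_minus: "score \<psi> (- z) = - score \<psi> z"
  by (simp add: score_def)

lemma score_zero [simp]: "score \<psi> 0 = 0"
  by (simp add: score_def)

text \<open>Any upper bound \<open>b\<close> is allowed here; the theorem takes the supremum, so
  that \<psi> exceeds \<open>b / 2\<close> somewhere.\<close>

locale bounded_score =
  fixes \<psi> :: "real \<Rightarrow> real" and \<beta> \<gamma> b :: real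
  assumes score: "score_function \<psi> \<beta> \<gamma>"
    and bound: "\<And>x. x \<ge> 0 \<Longrightarrow> \<psi> x \<le> b"
begin

lemma psi_nonneg: "x \<ge> 0 \<Longrightarrow> \<psi> x \<ge> 0"
  and psi_zero [simp]: "\<psi> 0 = 0"
  and continuous_on_psi: "continuous_on {0..} \<psi>"
  and concave_psi: "concave_on {0..} \<psi>"
  and beta_pos: "\<beta> > 0" and gamma_pos: "\<gamma> > 0"
  and psi_derivative_ge: "x \<ge> 0 \<Longrightarrow> (\<psi> has_real_derivative D) (at x within {0..}) \<Longrightarrow>
     \<gamma> * indicator {..\<beta>} x \<le> D"
  using score unfolding score_function_def by blast+

text \<open>This is the chord inequality with denominators cleared, so that degenerate intervals
  need no separate treatment later.\<close>

lemma psi_concave: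
  assumes "0 \<le> x" "x \<le> y" "y \<le> z"
  shows "(z - y) * \<psi> x + (y - x) * \<psi> z \<le> (z - x) * \<psi> y"
proof (cases "x = z")
  case False
  with assms have xz: "x < z" by simp
  define t where "t = (y - x) / (z - x)"
  have t: "0 \<le> t" "t \<le> 1" using assms xz by (auto simp: t_def)
  have tz: "t * (z - x) = y - x" using xz by (simp add: t_def)
  have "(1 - t) * \<psi> x + t * \<psi> z \<le> \<psi> ((1 - t) *\<^sub>R x + t *\<^sub>R z)"
    using concave_onD[OF concave_psi t, of x z] assms by auto
  also have "(1 - t) *\<^sub>R x + t *\<^sub>R z = y"
    using tz by (simp add: algebra_simps)
  finally have "(z - x) * ((1 - t) * \<psi> x + t * \<psi> z) \<le> (z - x) * \<psi> y"
    using xz by (intro mult_left_mono) auto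
  moreover have "(z - x) * ((1 - t) * \<psi> x + t * \<psi> z)
      = (z - x - t * (z - x)) * \<psi> x + (t * (z - x)) * \<psi> z"
    by (simp add: algebra_simps)
  ultimately show ?thesis unfolding tz by (simp add: algebra_simps)
qed (use assms in auto)

lemma psi_ratio_antimono:
  assumes "0 \<le> x" "x \<le> y"
  shows "x * \<psi> y \<le> y * \<psi> x"
  using psi_concave[of 0 x y] assms by simp

text \<open>A concave function that decreases once stays below a falling line from then on, and so
  cannot remain nonnegative on the half-line.\<close>

lemma psi_mono:
  assumes "0 \<le> x" "x \<le> y"
  shows "\<psi> x \<le> \<psi> y"
proof (rule ccontr)
  assume "\<not> \<psi> x \<le> \<psi> y"
  then have d: "\<psi> x - \<psi> y > 0" by simp
  \<comment> \<open>At this \<open>z\<close> the line through the graph points over \<open>x\<close>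
    and \<open>y\<close> has already dropped below zero; the \<open>+ 1\<close> makes this
    strict.\<close>
  define z where "z = y + ((y - x) * \<psi> y + 1) / (\<psi> x - \<psi> y)"
  have z: "y \<le> z" using assms psi_nonneg[of y] d by (auto simp: z_def)
  have "(z - y) * \<psi> x \<le> (z - x) * \<psi> y"
    using psi_concave[OF assms z] psi_nonneg[of z] z assms
      mult_nonneg_nonneg[of "y - x" "\<psi> z"] by linarith
  then have "(z - y) * (\<psi> x - \<psi> y) \<le> (y - x) * \<psi> y"
    by (simp add: algebra_simps)
  then show False using d by (simp add: z_def)
qed

lemma psi_pos:
  assumes "x > 0" shows "\<psi> x > 0"
proof (rule ccontr)
  assume "\<not> \<psi> x > 0"
  then have zero: "\<psi> y = 0" if "0 \<le> y" "y \<le> x" for y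
    using psi_mono[OF that] psi_nonneg[of y] that by linarith
  \<comment> \<open>This point is interior to the interval where \<psi> would vanish, and it is at
    most \<beta>, where the derivative is at least \<gamma>.\<close>
  define y where "y = min x \<beta> / 2"
  have y: "0 < y" "y < x" "y \<le> \<beta>" using assms beta_pos by (auto simp: y_def)
  have "((\<lambda>_. 0) has_real_derivative 0) (at y within {0..})"
    by simp
  then have "(\<psi> has_real_derivative 0) (at y within {0..})"
    by (rule has_field_derivative_transform_within[where d="x - y"])
      (use y zero in \<open>auto simp: dist_real_def\<close>)
  from psi_derivative_ge[OF _ this] y gamma_pos show False
    by (simp add: indicator_def)
qed

lemma bound_pos: "b > 0"
  using psi_pos[of 1] bound[of 1] by simp

lemma norm_score: "norm (score \<psi> z) = \<psi> (norm z)"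
  using psi_nonneg[of "norm z"] by (simp add: score_def)

lemma norm_score_le: "norm (score \<psi> z) \<le> b"
  by (simp add: norm_score bound)

text \<open>Only the origin is delicate: the norm of the field there tends to
  \<open>\<psi> 0 = 0\<close>.\<close>

lemma continuous_on_score: "continuous_on UNIV (score \<psi> :: 'a::euclidean_space \<Rightarrow> 'a)"
proof (rule continuous_at_imp_continuous_on, rule ballI)
  fix z :: 'a
  have n: "continuous_on UNIV (\<lambda>z::'a. \<psi> (norm z))"
    by (rule continuous_on_compose2[OF continuous_on_psi]) (auto intro!: continuous_intros)
  show "isCont (score \<psi>) z"
  proof (cases "z = 0")
    case True
    have "(\<lambda>z::'a. \<psi> (norm z)) \<midarrow>0\<rightarrow> \<psi> (norm (0::'a))"
      using n by (auto simp: continuous_on_eq_continuous_at isCont_def simp del: norm_zero)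
    then have "(\<lambda>z::'a. norm (score \<psi> z)) \<midarrow>0\<rightarrow> 0"
      by (simp add: norm_score)
    then show ?thesis
      unfolding True isCont_def score_zero by (rule tendsto_norm_zero_cancel)
  next
    case False
    have "isCont (\<lambda>z::'a. \<psi> (norm z)) z"
      using n by (simp add: continuous_on_eq_continuous_at)
    then show ?thesis
      using False unfolding score_def[abs_def] by (intro continuous_intros) auto
  qed
qed

lemma score_measurable [measurable]: "score \<psi> \<in> borel_measurable borel"
  by (rule borel_measurable_continuous_onI[OF continuous_on_score])

text \<open>Replacing the inner product of \<open>u\<close> and \<open>v\<close> by the product of
  their norms can only lower the expression. What remains is radial and nonnegative by monotonicity
  of \<psi>.\<close>

lemma score_monotone: "0 \<le> (score \<psi> u - score \<psi> v) \<bullet> (u - v)"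
proof -
  define k l where "k = \<psi> (norm u) / norm u" and "l = \<psi> (norm v) / norm v"
  have kl: "k * norm u = \<psi> (norm u)" "l * norm v = \<psi> (norm v)" "k \<ge> 0" "l \<ge> 0"
    using psi_nonneg by (auto simp: k_def l_def)
  have "(k + l) * (u \<bullet> v) \<le> (k + l) * (norm u * norm v)"
    using kl by (intro mult_left_mono norm_cauchy_schwarz) auto
  then have "(k * norm u - l * norm v) * (norm u - norm v) \<le> (k *\<^sub>R u - l *\<^sub>R v) \<bullet> (u - v)"
    by (simp add: algebra_simps inner_commute dot_square_norm power2_eq_square)
  moreover have "0 \<le> (\<psi> (norm u) - \<psi> (norm v)) * (norm u - norm v)"
    using psi_mono[of "norm u" "norm v"] psi_mono[of "norm v" "norm u"]
    by (cases "norm u \<le> norm v") (auto intro: mult_nonneg_nonneg mult_nonpos_nonpos)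
  ultimately show ?thesis
    unfolding kl by (simp add: score_def k_def l_def)
qed

lemma score_diff_le_of_norm_le:
  assumes "norm v \<le> norm u"
  shows "norm u * norm (score \<psi> u - score \<psi> v) \<le> 2 * b * norm (u - v)"
proof (cases "v = 0")
  case True
  have "norm u * \<psi> (norm u) \<le> norm u * (2 * b)"
    using bound[of "norm u"] bound_pos by (intro mult_left_mono) auto
  then show ?thesis
    by (simp add: True norm_score mult_ac)
next
  case False
  then have v: "norm v > 0" and u: "norm u > 0" using assms by (auto intro: less_le_trans)
  define k l where "k = \<psi> (norm u) / norm u" and "l = \<psi> (norm v) / norm v"
  have kl: "k * norm u = \<psi> (norm u)" "l * norm v = \<psi> (norm v)" "k \<ge> 0"
    using u v psi_nonneg by (auto simp: k_def l_def)
  have "k \<le> l"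
    using psi_ratio_antimono[OF _ assms] u v by (simp add: k_def l_def field_simps)
  \<comment> \<open>Both coefficients are nonnegative. The second term has norm at most
    \<open>k * (norm u - norm v)\<close>, hence at most \<open>k * norm (u - v)\<close>, which is
    also the norm of the first; this gives the factor 2.\<close>
  have "score \<psi> u - score \<psi> v = k *\<^sub>R (u - v) - (l - k) *\<^sub>R v"
    by (simp add: score_def k_def l_def algebra_simps)
  also have "norm \<dots> \<le> norm (k *\<^sub>R (u - v)) + norm ((l - k) *\<^sub>R v)"
    by (rule norm_triangle_ineq4)
  also have "\<dots> = k * norm (u - v) + (\<psi> (norm v) - k * norm v)"
    using kl \<open>k \<le> l\<close> by (simp add: left_diff_distrib)
  also have "\<psi> (norm v) \<le> k * norm u"
    using psi_mono[OF _ assms] kl by simp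
  also have "k * norm (u - v) + (k * norm u - k * norm v) \<le> 2 * k * norm (u - v)"
    using mult_left_mono[OF norm_triangle_ineq2[of u v] kl(3)] by (simp add: algebra_simps)
  finally have "norm u * norm (score \<psi> u - score \<psi> v) \<le> norm u * (2 * k * norm (u - v))"
    by (intro mult_left_mono) auto
  also have "\<dots> = 2 * (k * norm u) * norm (u - v)"
    by simp
  also have "\<dots> \<le> 2 * b * norm (u - v)"
    unfolding kl using bound[of "norm u"] by (intro mult_right_mono) auto
  finally show ?thesis .
qed

text \<open>Weakening the larger norm to \<open>norm v\<close> removes the ordering of
  \<open>u\<close> and \<open>v\<close>, so that \<open>v\<close> can be the sample point and
  \<open>u\<close> its shift.\<close>

lemma score_diff_le: "norm v * norm (score \<psi> u - score \<psi> v) \<le> 2 * b * norm (u - v)"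
proof (cases "norm v \<le> norm u")
  case True
  have "norm v * norm (score \<psi> u - score \<psi> v) \<le> norm u * norm (score \<psi> u - score \<psi> v)"
    using True by (intro mult_right_mono) auto
  with score_diff_le_of_norm_le[OF True] show ?thesis by linarith
next
  case False
  then show ?thesis
    using score_diff_le_of_norm_le[of u v] by (simp add: norm_minus_commute)
qed

section \<open>The mean score as a vector field in the parameter\<close>

definition mean_score :: "'a::euclidean_space measure \<Rightarrow> 'a \<Rightarrow> 'a" where
  "mean_score R \<theta> = (\<integral>x. score \<psi> (x - \<theta>) \<partial>R)"

lemma integrable_score:
  fixes R :: "'a::euclidean_space measure"
  assumes "prob_space R" "sets R = sets borel"
  shows "integrable R (\<lambda>x. score \<psi> (x - \<theta>))"
proof -
  interpret prob_space R by fact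
  note assms(2)[measurable_cong]
  show ?thesis
    by (rule integrable_const_bound[where B=b]) (auto simp: norm_score_le)
qed

lemma score_equation_iff:
  fixes R :: "'a::euclidean_space measure"
  assumes "prob_space R" "sets R = sets borel"
  shows "score_equation \<psi> R \<theta> \<longleftrightarrow> mean_score R \<theta> = 0"
  using integrable_score[OF assms]
  by (simp add: score_equation_def mean_score_def score_vector_eq_score[abs_def])

lemma continuous_on_mean_score:
  fixes R :: "'a::euclidean_space measure"
  assumes "prob_space R" "sets R = sets borel"
  shows "continuous_on UNIV (mean_score R)"
proof (rule continuous_on_sequentiallyI)
  interpret prob_space R by fact
  note assms(2)[measurable_cong]
  fix u :: "nat \<Rightarrow> 'a" and a
  assume u: "u \<longlonglongrightarrow> a"
  have cont: "isCont (score \<psi>) z" for z :: 'a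
    using continuous_on_score[where 'a='a] by (auto simp: continuous_on_eq_continuous_at)
  show "(\<lambda>n. mean_score R (u n)) \<longlonglongrightarrow> mean_score R a"
    unfolding mean_score_def
    by (rule integral_dominated_convergence[where w="\<lambda>_. b"])
      (auto simp: norm_score_le intro!: isCont_tendsto_compose[OF cont] tendsto_intros u)
qed

text \<open>Strictness comes from the midpoint of the two parameters: the continuous monotonicity
  integrand is positive there, hence on a set of positive measure.\<close>
lemma mean_score_strictly_monotone:
  fixes R :: "'a::euclidean_space measure"
  assumes R: "prob_space R" "sets R = sets borel" and ac: "absolutely_continuous R lborel"
    and ne: "\<theta> \<noteq> \<eta>"
  shows "(mean_score R \<theta> - mean_score R \<eta>) \<bullet> (\<theta> - \<eta>) < 0"
proof -
  define g where "g x = (score \<psi> (x - \<theta>) - score \<psi> (x - \<eta>)) \<bullet> (\<eta> - \<theta>)" for x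
  have g_nonneg: "0 \<le> g x" for x
    using score_monotone[of "x - \<theta>" "x - \<eta>"] by (simp add: g_def)
  have int: "integrable R g"
    unfolding g_def by (intro integrable_inner_left Bochner_Integration.integrable_diff integrable_score R)
  have eq: "(\<integral>x. g x \<partial>R) = - ((mean_score R \<theta> - mean_score R \<eta>) \<bullet> (\<theta> - \<eta>))"
    unfolding g_def mean_score_def
    by (simp add: integrable_score R Bochner_Integration.integrable_diff algebra_simps)
  have "(\<integral>x. g x \<partial>R) \<noteq> 0"
  proof
    assume "(\<integral>x. g x \<partial>R) = 0"
    then have "AE x in R. g x = 0"
      using integral_nonneg_eq_0_iff_AE[OF int] g_nonneg by auto
    \<comment> \<open>In this argument order, \<open>absolutely_continuous R lborel\<close> says
      that every \<open>R\<close>-null set is Lebesgue-null, so almost-everywhere statements pass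
      from \<open>R\<close> to \<open>lborel\<close>.\<close>
    then have "AE x in lborel. g x = 0"
      by (intro absolutely_continuous_AE[OF _ ac]) (auto simp: R)
    then have ae: "AE x in lebesgue. x \<in> {x. g x = 0}"
      using AE_completion by fastforce
    have "continuous_on UNIV g"
      unfolding g_def
      by (intro continuous_intros continuous_on_compose2[OF continuous_on_score]) auto
    then have "closed {x. g x = 0}"
      by (intro closed_Collect_eq continuous_intros)
    from mem_closed_if_AE_lebesgue[OF this ae] have mid: "g ((1/2) *\<^sub>R (\<theta> + \<eta>)) = 0"
      by auto
    define h where "h = (1/2) *\<^sub>R (\<eta> - \<theta>)"
    have h: "(1/2) *\<^sub>R (\<theta> + \<eta>) - \<theta> = h" "(1/2) *\<^sub>R (\<theta> + \<eta>) - \<eta> = - h" "\<eta> - \<theta> = 2 *\<^sub>R h" "h \<noteq> 0"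
      using ne by (auto simp: h_def algebra_simps simp flip: scaleR_add_left)
    \<comment> \<open>The two arguments are \<open>h\<close> and \<open>- h\<close>, so oddness
      doubles the score; \<open>\<eta> - \<theta> = 2 *\<^sub>R h\<close> gives the other factor
      2.\<close>
    have "g ((1/2) *\<^sub>R (\<theta> + \<eta>)) = 4 * (\<psi> (norm h) * norm h)"
      unfolding g_def h score_minus using h(4)
      by (simp add: score_def inner_add_left dot_square_norm power2_eq_square)
    with mid psi_pos[of "norm h"] h(4) show False by simp
  qed
  moreover have "(\<integral>x. g x \<partial>R) \<ge> 0"
    by (rule integral_nonneg_AE) (simp add: g_nonneg)
  ultimately show ?thesis using eq by linarith
qed

lemma mean_score_inj:
  fixes R :: "'a::euclidean_space measure"
  assumes "prob_space R" "sets R = sets borel" "absolutely_continuous R lborel"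
    and "mean_score R \<theta> = mean_score R \<eta>"
  shows "\<theta> = \<eta>"
  using mean_score_strictly_monotone[OF assms(1-3), of \<theta> \<eta>] assms(4) by auto

lemma mean_score_mixture_return:
  fixes R :: "'a::euclidean_space measure"
  assumes R: "prob_space R" "sets R = sets borel" and \<epsilon>: "0 < \<epsilon>" "\<epsilon> < 1"
  shows "mean_score (mixture \<epsilon> R (return borel q)) \<theta> =
    (1 - \<epsilon>) *\<^sub>R mean_score R \<theta> + \<epsilon> *\<^sub>R score \<psi> (q - \<theta>)"
proof -
  have Q: "prob_space (return borel q)" by (rule prob_space_return) simp
  have M: "prob_space (mixture \<epsilon> R (return borel q))"
    by (rule prob_space_mixture[OF R(1) Q]) (use R \<epsilon> in auto)
  show ?thesis
    unfolding mean_score_def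
    by (subst integral_mixture[OF R(1) Q _ \<epsilon> integrable_score[OF M]])
      (auto simp: R sets_mixture integral_return)
qed

text \<open>Subtracting the vanishing mean at 0 turns the mean into one of increments. Each is
  bounded by \<open>score_diff_le\<close> with the sample point as \<open>v\<close>, and dividing by
  its norm is legitimate almost everywhere.\<close>

lemma mean_score_lipschitz_at_center:
  fixes R :: "'a::euclidean_space measure"
  assumes R: "prob_space R" "sets R = sets borel" and inv: "integrable R (\<lambda>x. 1 / norm x)"
    and nz: "AE x in R. x \<noteq> 0" and center: "mean_score R 0 = 0"
  shows "norm (mean_score R \<theta>) \<le> 2 * b * norm \<theta> * (\<integral>x. 1 / norm x \<partial>R)"
proof -
  have "mean_score R \<theta> = (\<integral>x. score \<psi> (x - \<theta>) - score \<psi> x \<partial>R)"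
    using center integrable_score[OF R, of 0]
    by (simp add: mean_score_def Bochner_Integration.integral_diff integrable_score[OF R])
  also have "norm \<dots> \<le> (\<integral>x. norm (score \<psi> (x - \<theta>) - score \<psi> x) \<partial>R)"
    by (rule integral_norm_bound)
  also have "\<dots> \<le> (\<integral>x. 2 * b * norm \<theta> * (1 / norm x) \<partial>R)"
  proof (rule integral_mono_AE)
    show "AE x in R. norm (score \<psi> (x - \<theta>) - score \<psi> x) \<le> 2 * b * norm \<theta> * (1 / norm x)"
      using nz
    proof eventually_elim
      case (elim x)
      then show ?case
        using score_diff_le[of x "x - \<theta>"] by (simp add: field_simps)
    qed
    show "integrable R (\<lambda>x. norm (score \<psi> (x - \<theta>) - score \<psi> x))"
      using integrable_score[OF R, of 0] integrable_score[OF R, of \<theta>]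
      by (intro integrable_norm Bochner_Integration.integrable_diff) auto
  qed (intro integrable_mult_right inv)
  finally show ?thesis
    by (simp only: integral_mult_right_zero)
qed

end

section \<open>Null sets of mixtures and Gaussian moments\<close>

lemma absolutely_continuous_mixture:
  assumes ac: "absolutely_continuous P N" and QP: "sets Q = sets P" and "\<epsilon> < 1"
  shows "absolutely_continuous (mixture \<epsilon> P Q) N"
  unfolding absolutely_continuous_def
proof
  fix A assume "A \<in> null_sets (mixture \<epsilon> P Q)"
  then have A: "A \<in> sets P" and "emeasure (mixture \<epsilon> P Q) A = 0"
    by (auto simp: null_sets_def sets_mixture)
  then have "ennreal (1 - \<epsilon>) * emeasure P A = 0"
    by (simp add: emeasure_mixture[OF QP])
  then have "A \<in> null_sets P"
    using A \<open>\<epsilon> < 1\<close> by (auto simp: null_sets_def)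
  with ac show "A \<in> null_sets N"
    by (auto simp: absolutely_continuous_def)
qed

lemma sets_isotropic_normal [simp, measurable_cong]: "sets (isotropic_normal \<mu> \<sigma>) = sets borel"
  by (simp add: isotropic_normal_def)

text \<open>The density is positive everywhere, so the null sets are the Lebesgue ones. The first
  direction feeds strict monotonicity, the second discards the origin.\<close>

lemma absolutely_continuous_isotropic_normal:
  fixes \<mu> :: "'a::euclidean_space"
  assumes "\<sigma> > 0"
  shows "absolutely_continuous (isotropic_normal \<mu> \<sigma>) lborel"
    and "absolutely_continuous lborel (isotropic_normal \<mu> \<sigma>)"
proof -
  let ?f = "\<lambda>x::'a. ennreal (\<Prod>b\<in>Basis. normal_density (\<mu> \<bullet> b) \<sigma> (x \<bullet> b))"
  have pos: "?f x > 0" for x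
    using assms by (auto intro!: prod_pos normal_density_pos)
  have "null_sets (isotropic_normal \<mu> \<sigma>) = null_sets lborel"
    unfolding isotropic_normal_def
  proof (intro set_eqI)
    fix A :: "'a set"
    have "A \<in> null_sets (density lborel ?f) \<longleftrightarrow> A \<in> sets lborel \<and> (AE x in lborel. x \<in> A \<longrightarrow> ?f x = 0)"
      by (rule null_sets_density_iff) simp
    also have "\<dots> \<longleftrightarrow> A \<in> sets lborel \<and> (AE x in lborel. x \<notin> A)"
      using pos by (simp add: less_le)
    finally show "A \<in> null_sets (density lborel ?f) \<longleftrightarrow> A \<in> null_sets lborel"
      by (metis AE_iff_null_sets null_setsD2)
  qed
  then show "absolutely_continuous (isotropic_normal \<mu> \<sigma>) lborel"
      "absolutely_continuous lborel (isotropic_normal \<mu> \<sigma>)"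
    by (auto simp: absolutely_continuous_def)
qed

text \<open>Reflection preserves Lebesgue measure and the density is even, so the integral equals
  its own negative.\<close>

lemma integral_isotropic_normal_odd:
  fixes f :: "'a::euclidean_space \<Rightarrow> 'b::{banach, second_countable_topology}"
  assumes f: "f \<in> borel_measurable borel" and odd: "\<And>x. f (- x) = - f x"
  shows "(\<integral>x. f x \<partial>isotropic_normal 0 \<sigma>) = 0"
proof -
  note f [measurable]
  let ?w = "\<lambda>x::'a. \<Prod>b\<in>Basis. normal_density 0 \<sigma> (x \<bullet> b)"
  let ?I = "\<integral>x. ?w x *\<^sub>R f x \<partial>lborel"
  have "lborel = distr lborel borel (uminus :: 'a \<Rightarrow> 'a)"
    using lborel_affine[of "-1::real" "0::'a"] by (simp add: density_1 one_ennreal_def[symmetric])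
  then have "?I = (\<integral>x. ?w x *\<^sub>R f x \<partial>distr lborel borel uminus)"
    by simp
  also have "\<dots> = (\<integral>x. ?w (- x) *\<^sub>R f (- x) \<partial>lborel)"
    by (rule integral_distr) auto
  also have "\<dots> = (\<integral>x. - (?w x *\<^sub>R f x) \<partial>lborel)"
    by (simp add: odd normal_density_def)
  finally have "?I = - ?I" by simp
  then have "?I = 0" by (simp add: eq_neg_iff_add_eq_0 flip: scaleR_2)
  then show ?thesis
    unfolding isotropic_normal_def
    by (subst integral_density) (auto intro!: AE_I2 prod_nonneg)
qed

text \<open>The exponents add: \<open>s\<close> is the deviation with 1/s^2 = 1/\<sigma>^2 + 2t, and
  the square root corrects the normalisation.\<close>

lemma normal_density_mult_exp:
  assumes "\<sigma> > 0" "t \<ge> 0"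
  defines "s \<equiv> \<sigma> / sqrt (1 + 2 * t * \<sigma>\<^sup>2)"
  shows "normal_density 0 \<sigma> x * exp (- (t * x\<^sup>2)) = normal_density 0 s x / sqrt (1 + 2 * t * \<sigma>\<^sup>2)"
proof -
  define k where "k = 1 + 2 * t * \<sigma>\<^sup>2"
  have k: "k > 0" using assms by (simp add: k_def add_pos_nonneg)
  have s2: "s\<^sup>2 = \<sigma>\<^sup>2 / k" using k by (simp add: s_def k_def power_divide)
  have "- (x\<^sup>2 / (2 * \<sigma>\<^sup>2)) + - (t * x\<^sup>2) = - (x\<^sup>2 / (2 * s\<^sup>2))"
    using assms k unfolding s2 by (simp add: k_def field_simps)
  then have e: "exp (- (x\<^sup>2 / (2 * \<sigma>\<^sup>2))) * exp (- (t * x\<^sup>2)) = exp (- (x\<^sup>2 / (2 * s\<^sup>2)))"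
    by (simp flip: exp_add)
  have "sqrt (2 * pi * s\<^sup>2) * sqrt k = sqrt (2 * pi * \<sigma>\<^sup>2)"
    using k unfolding s2 by (simp flip: real_sqrt_mult)
  then show ?thesis
    using e k assms unfolding k_def[symmetric] normal_density_def
    by (simp add: field_simps)
qed

text \<open>The integrand factors over coordinates, and each factor is a rescaled normal density of
  total mass \<open>1 / sqrt k\<close>.\<close>

lemma nn_integral_isotropic_normal_exp:
  assumes "\<sigma> > 0" "t \<ge> 0"
  shows "(\<integral>\<^sup>+x. ennreal (exp (- (t * (norm x)\<^sup>2))) \<partial>isotropic_normal (0::'a::euclidean_space) \<sigma>)
    = ennreal ((1 + 2 * t * \<sigma>\<^sup>2) powr (- (real DIM('a) / 2)))"
proof -
  define k where "k = 1 + 2 * t * \<sigma>\<^sup>2"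
  have k: "k > 0" using assms by (simp add: k_def add_pos_nonneg)
  have "(\<integral>\<^sup>+x. ennreal (exp (- (t * (norm x)\<^sup>2))) \<partial>isotropic_normal (0::'a) \<sigma>)
     = (\<integral>\<^sup>+x. (\<Prod>b\<in>Basis. ennreal (normal_density 0 \<sigma> (x \<bullet> b))) * ennreal (exp (- (t * (norm (x::'a))\<^sup>2))) \<partial>lborel)"
    unfolding isotropic_normal_def
    by (subst nn_integral_density) (auto simp: prod_ennreal)
  also have "\<dots> = (\<integral>\<^sup>+x. (\<Prod>b\<in>Basis. ennreal (normal_density 0 \<sigma> ((x::'a) \<bullet> b) * exp (- (t * (x \<bullet> b)\<^sup>2)))) \<partial>lborel)"
  proof (rule nn_integral_cong)
    fix x :: 'a
    have "(norm x)\<^sup>2 = (\<Sum>b\<in>Basis. (x \<bullet> b)\<^sup>2)"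
      unfolding dot_square_norm[symmetric] by (subst euclidean_inner) (simp add: power2_eq_square)
    then have "exp (- (t * (norm x)\<^sup>2)) = (\<Prod>b\<in>Basis. exp (- (t * (x \<bullet> b)\<^sup>2)))"
      by (simp add: sum_distrib_left exp_sum flip: sum_negf)
    then show "(\<Prod>b\<in>Basis. ennreal (normal_density 0 \<sigma> (x \<bullet> b))) * ennreal (exp (- (t * (norm x)\<^sup>2)))
        = (\<Prod>b\<in>Basis. ennreal (normal_density 0 \<sigma> (x \<bullet> b) * exp (- (t * (x \<bullet> b)\<^sup>2))))"
      by (simp add: prod_ennreal prod.distrib prod_nonneg flip: ennreal_mult)
  qed
  also have "\<dots> = (\<Prod>b\<in>(Basis::'a set). \<integral>\<^sup>+x. ennreal (normal_density 0 \<sigma> x * exp (- (t * x\<^sup>2))) \<partial>lborel)"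
    by (rule nn_integral_lborel_prod) auto
  also have "(\<integral>\<^sup>+x. ennreal (normal_density 0 \<sigma> x * exp (- (t * x\<^sup>2))) \<partial>lborel)
      = (\<integral>\<^sup>+x. ennreal (1 / sqrt k) * ennreal (normal_density 0 (\<sigma> / sqrt k) x) \<partial>lborel)"
    using k by (simp add: normal_density_mult_exp[OF assms] k_def flip: ennreal_mult)
  also have "\<dots> = ennreal (1 / sqrt k) * (\<integral>\<^sup>+x. ennreal (normal_density 0 (\<sigma> / sqrt k) x) \<partial>lborel)"
    by (rule nn_integral_cmult) auto
  also have "(\<integral>\<^sup>+x. ennreal (normal_density 0 (\<sigma> / sqrt k) x) \<partial>lborel) = 1"
    using assms k by (simp add: nn_integral_eq_integral normal_density_nonneg)
  also have "(\<Prod>b\<in>(Basis::'a set). ennreal (1 / sqrt k) * 1) = ennreal ((1 / sqrt k) ^ DIM('a))"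
    using k by (simp add: ennreal_power)
  also have "(1 / sqrt k) ^ DIM('a) = k powr (- (real DIM('a) / 2))"
  proof -
    have "1 / sqrt k = k powr (- (1 / 2))"
      using k unfolding powr_minus_divide by (simp add: powr_half_sqrt)
    moreover have "(k powr (- (1 / 2))) ^ DIM('a) = (k powr (- (1 / 2))) powr real DIM('a)"
      using k by (subst powr_realpow) auto
    ultimately show ?thesis by (simp add: powr_powr)
  qed
  finally show ?thesis by (simp add: k_def)
qed

lemma prob_space_isotropic_normal:
  assumes "\<sigma> > 0"
  shows "prob_space (isotropic_normal (0::'a::euclidean_space) \<sigma>)"
  using nn_integral_isotropic_normal_exp[OF assms, of 0, where 'a='a]
  by (intro prob_spaceI) simp

text \<open>Writing \<open>1/r\<^sup>2\<close> as the integral of \<open>exp (-t r\<^sup>2)\<close> over \<open>t \<ge> 0\<close> reduces this to the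
  Laplace transform of \<open>r\<^sup>2\<close>.\<close>
lemma nn_integral_isotropic_normal_inverse_square:
  assumes \<sigma>: "\<sigma> > 0" and dim: "DIM('a::euclidean_space) > 2"
  shows "(\<integral>\<^sup>+x. ennreal (1 / (norm x)\<^sup>2) \<partial>isotropic_normal (0::'a) \<sigma>)
    = ennreal (1 / (\<sigma>\<^sup>2 * (real DIM('a) - 2)))"
proof -
  let ?P = "isotropic_normal (0::'a) \<sigma>"
  interpret P: prob_space ?P by (rule prob_space_isotropic_normal[OF \<sigma>])
  interpret pair_sigma_finite lborel ?P ..
  define m where "m = real DIM('a) / 2"
  have m: "m > 1" using dim by (simp add: m_def)
  \<comment> \<open>At the origin the two integrands differ: \<open>1 / 0\<close> is 0, while the
    integral over \<open>t\<close> is infinite.\<close>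
  have "AE x in ?P. x \<noteq> 0"
    by (rule absolutely_continuous_AE[OF _ absolutely_continuous_isotropic_normal(2)[OF \<sigma>]])
      (auto intro: AE_lborel_singleton)
  then have "(\<integral>\<^sup>+x. ennreal (1 / (norm x)\<^sup>2) \<partial>?P)
     = (\<integral>\<^sup>+x. (\<integral>\<^sup>+t. ennreal (exp (- (t * (norm x)\<^sup>2))) * indicator {0..} t \<partial>lborel) \<partial>?P)"
  proof (intro nn_integral_cong_AE, eventually_elim)
    fix x :: 'a assume x: "x \<noteq> 0"
    define r where "r = (norm x)\<^sup>2"
    have r: "r > 0" using x by (simp add: r_def)
    have "((\<lambda>t. - exp (- (t * r)) / r) \<longlongrightarrow> 0) at_top"
      using r by real_asymp
    then have "(\<integral>\<^sup>+t. ennreal (exp (- (t * r))) * indicator {0..} t \<partial>lborel)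
        = ennreal (0 - (- exp (- (0 * r)) / r))"
      using r by (intro nn_integral_FTC_atLeast) (auto intro!: derivative_eq_intros)
    then show "ennreal (1 / (norm x)\<^sup>2)
        = (\<integral>\<^sup>+t. ennreal (exp (- (t * (norm x)\<^sup>2))) * indicator {0..} t \<partial>lborel)"
      by (simp add: r_def)
  qed
  also have "\<dots> = (\<integral>\<^sup>+t. (\<integral>\<^sup>+x. ennreal (exp (- (t * (norm x)\<^sup>2))) * indicator {0..} t \<partial>?P) \<partial>lborel)"
    by (rule Fubini') measurable
  also have "\<dots> = (\<integral>\<^sup>+t. ennreal ((1 + 2 * t * \<sigma>\<^sup>2) powr (- m)) * indicator {0..} t \<partial>lborel)"
    by (intro nn_integral_cong)
      (auto simp: indicator_def m_def nn_integral_isotropic_normal_exp[OF \<sigma>] split: if_splits)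
  \<comment> \<open>Since \<open>m > 1\<close>, the exponent \<open>1 - m\<close> of the
    antiderivative is negative and its limit at infinity is 0.\<close>
  also have "\<dots> = ennreal (0 - (- ((1 + 2 * 0 * \<sigma>\<^sup>2) powr (1 - m)) / (2 * \<sigma>\<^sup>2 * (m - 1))))"
  proof (rule nn_integral_FTC_atLeast)
    show "((\<lambda>t. - ((1 + 2 * t * \<sigma>\<^sup>2) powr (1 - m)) / (2 * \<sigma>\<^sup>2 * (m - 1))) \<longlongrightarrow> 0) at_top"
      using m \<sigma> by real_asymp
    fix t :: real assume "t \<ge> 0"
    then have t: "1 + 2 * t * \<sigma>\<^sup>2 > 0" by (simp add: add_pos_nonneg)
    have "((\<lambda>t. 1 + 2 * t * \<sigma>\<^sup>2) has_real_derivative 2 * \<sigma>\<^sup>2) (at t)"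
      by (auto intro!: derivative_eq_intros)
    from DERIV_chain2[OF has_real_derivative_powr[OF t] this]
    have "((\<lambda>t. (1 + 2 * t * \<sigma>\<^sup>2) powr (1 - m)) has_real_derivative
        (1 - m) * (1 + 2 * t * \<sigma>\<^sup>2) powr (1 - m - 1) * (2 * \<sigma>\<^sup>2)) (at t)" .
    from DERIV_cdivide[OF DERIV_minus[OF this]]
    have "((\<lambda>t. - ((1 + 2 * t * \<sigma>\<^sup>2) powr (1 - m)) / (2 * \<sigma>\<^sup>2 * (m - 1))) has_real_derivative
       - ((1 - m) * (1 + 2 * t * \<sigma>\<^sup>2) powr (1 - m - 1) * (2 * \<sigma>\<^sup>2)) / (2 * \<sigma>\<^sup>2 * (m - 1))) (at t)" .
    moreover have "1 - m - 1 = - m" by simp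
    moreover have "- ((1 - m) * p * (2 * \<sigma>\<^sup>2)) / (2 * \<sigma>\<^sup>2 * (m - 1)) = p" for p
    proof -
      have "- ((1 - m) * p * (2 * \<sigma>\<^sup>2)) = p * (2 * \<sigma>\<^sup>2 * (m - 1))"
        by (simp add: algebra_simps)
      moreover have "2 * \<sigma>\<^sup>2 * (m - 1) \<noteq> 0" using m \<sigma> by simp
      ultimately show ?thesis by (simp only:) (erule nonzero_mult_div_cancel_right)
    qed
    ultimately show "((\<lambda>t. - ((1 + 2 * t * \<sigma>\<^sup>2) powr (1 - m)) / (2 * \<sigma>\<^sup>2 * (m - 1))) has_real_derivative
       (1 + 2 * t * \<sigma>\<^sup>2) powr (- m)) (at t)"
      by (simp only:)
  qed auto
  also have "0 - (- ((1 + 2 * 0 * \<sigma>\<^sup>2) powr (1 - m)) / (2 * \<sigma>\<^sup>2 * (m - 1))) = 1 / (\<sigma>\<^sup>2 * (real DIM('a) - 2))"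
  proof -
    have "2 * \<sigma>\<^sup>2 * (m - 1) = \<sigma>\<^sup>2 * (real DIM('a) - 2)"
      by (simp add: m_def algebra_simps)
    then show ?thesis by (simp only:) simp
  qed
  finally show ?thesis .
qed

text \<open>With \<open>l\<close> the root of the inverse second moment, 1/r is at most l/2 + 1/(2 l
  r^2) by the arithmetic-geometric mean inequality. Both terms have mean l/2, so integrability and
  the bound come together.\<close>

lemma isotropic_normal_inverse_norm:
  fixes \<sigma> :: real
  assumes \<sigma>: "\<sigma> > 0" and dim: "DIM('a::euclidean_space) > 2"
  shows "integrable (isotropic_normal (0::'a) \<sigma>) (\<lambda>x. 1 / norm x)"
    and "(\<integral>x. 1 / norm x \<partial>isotropic_normal (0::'a) \<sigma>) \<le> 1 / (\<sigma> * sqrt (real DIM('a) - 2))"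
proof -
  let ?P = "isotropic_normal (0::'a) \<sigma>"
  interpret P: prob_space ?P by (rule prob_space_isotropic_normal[OF \<sigma>])
  define l where "l = 1 / (\<sigma> * sqrt (real DIM('a) - 2))"
  have l: "l > 0" using \<sigma> dim by (simp add: l_def)
  have l2: "l\<^sup>2 = 1 / (\<sigma>\<^sup>2 * (real DIM('a) - 2))"
    using dim by (simp add: l_def power_divide power_mult_distrib)
  have sq: "has_bochner_integral ?P (\<lambda>x. 1 / (norm x)\<^sup>2) (l\<^sup>2)"
    by (rule has_bochner_integral_nn_integral)
      (simp_all add: nn_integral_isotropic_normal_inverse_square[OF assms] flip: l2)
  define c where "c = 1 / (2 * l)"
  have dom: "has_bochner_integral ?P (\<lambda>x. l / 2 + c * (1 / (norm x)\<^sup>2)) (l / 2 + c * l\<^sup>2)"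
    by (intro has_bochner_integral_add has_bochner_integral_mult_right sq)
      (simp add: has_bochner_integral_iff P.prob_space)
  have le: "1 / norm x \<le> l / 2 + c * (1 / (norm x)\<^sup>2)" for x :: 'a
  proof -
    have "0 \<le> (1 / norm x - l)\<^sup>2" by simp
    then have "2 * l * (1 / norm x) \<le> l\<^sup>2 + 1 / (norm x)\<^sup>2"
      by (simp add: power2_diff power_divide)
    then have "c * (2 * l * (1 / norm x)) \<le> c * (l\<^sup>2 + 1 / (norm x)\<^sup>2)"
      using l by (intro mult_left_mono) (auto simp: c_def)
    moreover have "c * (2 * l * (1 / norm x)) = 1 / norm x" "c * l\<^sup>2 = l / 2"
      using l by (auto simp: c_def power2_eq_square)
    ultimately show ?thesis
      by (simp only: distrib_left)
  qed
  show int: "integrable ?P (\<lambda>x. 1 / norm x)"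
    by (rule Bochner_Integration.integrable_bound[OF dom[THEN integrable.intros]])
      (use le l in \<open>auto intro!: order_trans[OF _ abs_ge_self]\<close>)
  have "(\<integral>x. 1 / norm x \<partial>?P) \<le> (\<integral>x. l / 2 + c * (1 / (norm x)\<^sup>2) \<partial>?P)"
    using dom[THEN integrable.intros] le by (intro integral_mono int) auto
  also have "\<dots> = l"
    using has_bochner_integral_integral_eq[OF dom] l by (simp add: c_def power2_eq_square)
  finally show "(\<integral>x. 1 / norm x \<partial>?P) \<le> 1 / (\<sigma> * sqrt (real DIM('a) - 2))"
    by (simp add: l_def)
qed

theorem theorem3:
  fixes \<psi> :: "real \<Rightarrow> real" and \<beta> \<gamma> \<sigma> :: real and P :: "(real ^ 'n) measure"
  assumes "CARD('n) \<ge> 2"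
    and "\<sigma> > 0"
    and "P = isotropic_normal 0 \<sigma>"
    and "score_function \<psi> \<beta> \<gamma>"
    and "bounded (\<psi> ` {0..})"
    and "(\<integral>x. rho \<psi> (norm (x - (\<integral>y. y \<partial>P))) \<partial>P) < min (rho \<psi> (\<beta> / 3)) ((\<psi> (\<beta> / 2))\<^sup>2 / 2)"
  shows "\<exists>(Q :: (real ^ 'n) measure) \<epsilon>max. prob_space Q \<and> sets Q = sets borel \<and> \<epsilon>max > 0 \<and>
    (\<forall>\<epsilon>. 0 < \<epsilon> \<and> \<epsilon> < \<epsilon>max \<longrightarrow>
      (\<exists>!\<theta>. score_equation \<psi> P \<theta>) \<and>
      (\<exists>!\<theta>. score_equation \<psi> (mixture \<epsilon> P Q) \<theta>) \<and>
      norm (T_functional \<psi> P - T_functional \<psi> (mixture \<epsilon> P Q)) =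
        norm (T_functional \<psi> (mixture \<epsilon> P Q)) \<and>
      norm (T_functional \<psi> (mixture \<epsilon> P Q)) \<ge> \<sigma> * (\<epsilon> * sqrt (real CARD('n) - 2) / 12))"
proof -
  define b where "b = Sup (\<psi> ` {0..})"
  have bdd: "bdd_above (\<psi> ` {0..})"
    using assms(5) by (rule bounded_imp_bdd_above)
  interpret bounded_score \<psi> \<beta> \<gamma> b
    by unfold_locales (use assms(4) bdd in \<open>auto simp: b_def intro: cSup_upper\<close>)
  have "b / 2 < Sup (\<psi> ` {0..})"
    using bound_pos by (simp add: b_def)
  then obtain m where m: "m \<ge> 0" "b / 2 < \<psi> m"
    by (subst (asm) less_cSup_iff) (use bdd in auto)
  \<comment> \<open>The extra 1 keeps \<open>q\<close> at distance at least \<open>m\<close> from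
    every point of the unit ball, where the zero will be located.\<close>
  obtain q :: "real ^ 'n" where q: "norm q = m + 1"
    using vector_choose_size[of "m + 1"] m(1) by auto
  define Q where "Q = return borel q"
  have Q: "prob_space Q" "sets Q = sets borel"
    by (auto simp: Q_def intro: prob_space_return)
  have P: "prob_space P" "sets P = sets borel" "absolutely_continuous P lborel"
    using assms(2) by (simp_all add: assms(3) prob_space_isotropic_normal absolutely_continuous_isotropic_normal)
  have center: "mean_score P 0 = 0"
    unfolding mean_score_def assms(3)
    by (rule integral_isotropic_normal_odd) (auto simp: score_minus)
  have P_eq: "score_equation \<psi> P \<theta> \<longleftrightarrow> \<theta> = 0" for \<theta>
    using score_equation_iff[OF P(1,2)] mean_score_inj[OF P, of \<theta> 0] center by auto
  have TP: "T_functional \<psi> P = 0"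
    by (simp add: T_functional_def P_eq)
  have "continuous_on (sphere 0 1) (\<lambda>\<theta>::real^'n. mean_score P \<theta> \<bullet> \<theta>)"
    by (intro continuous_intros continuous_on_subset[OF continuous_on_mean_score[OF P(1,2)]]) auto
  moreover have "sphere (0::real^'n) 1 \<noteq> {}"
    using vector_choose_size[of 1, where 'a="real^'n"] by auto
  ultimately have "\<exists>\<eta>\<in>sphere 0 1. \<forall>\<theta>\<in>sphere 0 1. mean_score P \<theta> \<bullet> \<theta> \<le> mean_score P \<eta> \<bullet> \<eta>"
    by (intro continuous_attains_sup compact_sphere)
  then obtain \<theta>0 :: "real^'n" where \<theta>0: "norm \<theta>0 = 1"
    "\<And>\<theta>. norm \<theta> = 1 \<Longrightarrow> mean_score P \<theta> \<bullet> \<theta> \<le> mean_score P \<theta>0 \<bullet> \<theta>0"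
    by auto
  \<comment> \<open>By compactness, \<open>c\<close> is the smallest inward pull of \<open>P\<close>
    over the unit sphere.\<close>
  define c where "c = - (mean_score P \<theta>0 \<bullet> \<theta>0)"
  have c: "c > 0"
    using mean_score_strictly_monotone[OF P, of \<theta>0 0] \<theta>0(1) center
    by (cases "\<theta>0 = 0") (auto simp: c_def)
  \<comment> \<open>This is the threshold below which the outward push of \<open>Q\<close>, at most
    \<open>\<epsilon> * b\<close>, is weaker than the pull \<open>(1 - \<epsilon>) * c\<close> of
    \<open>P\<close>.\<close>
  define \<epsilon>max where "\<epsilon>max = c / (b + c)"
  have "\<epsilon>max > 0" using c bound_pos by (simp add: \<epsilon>max_def)
  moreover have "(\<exists>!\<theta>. score_equation \<psi> P \<theta>) \<and>
      (\<exists>!\<theta>. score_equation \<psi> (mixture \<epsilon> P Q) \<theta>) \<and>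
      norm (T_functional \<psi> P - T_functional \<psi> (mixture \<epsilon> P Q)) =
        norm (T_functional \<psi> (mixture \<epsilon> P Q)) \<and>
      norm (T_functional \<psi> (mixture \<epsilon> P Q)) \<ge> \<sigma> * (\<epsilon> * sqrt (real CARD('n) - 2) / 12)"
    if \<epsilon>: "0 < \<epsilon>" "\<epsilon> < \<epsilon>max" for \<epsilon>
  proof -
    let ?M = "mixture \<epsilon> P Q"
    have \<epsilon>c: "\<epsilon> * b < (1 - \<epsilon>) * c"
      using \<epsilon>(2) c bound_pos by (simp add: \<epsilon>max_def field_simps)
    have \<epsilon>1: "\<epsilon> < 1"
    proof -
      have "\<epsilon>max < 1" using c bound_pos by (simp add: \<epsilon>max_def)
      with \<epsilon>(2) show ?thesis by simp
    qed
    have M: "prob_space ?M" "sets ?M = sets borel" "absolutely_continuous ?M lborel"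
      using P Q \<epsilon> \<epsilon>1 by (auto simp: sets_mixture intro!: prob_space_mixture absolutely_continuous_mixture)
    have mean: "mean_score ?M \<theta> = (1 - \<epsilon>) *\<^sub>R mean_score P \<theta> + \<epsilon> *\<^sub>R score \<psi> (q - \<theta>)" for \<theta>
      unfolding Q_def by (rule mean_score_mixture_return[OF P(1,2) \<epsilon>(1) \<epsilon>1])
    have "mean_score ?M \<theta> \<bullet> \<theta> < 0" if "norm \<theta> = 1" for \<theta>
    proof -
      have "score \<psi> (q - \<theta>) \<bullet> \<theta> \<le> b"
        using norm_cauchy_schwarz[of "score \<psi> (q - \<theta>)" \<theta>] norm_score_le[of "q - \<theta>"] that by simp
      then have "\<epsilon> * (score \<psi> (q - \<theta>) \<bullet> \<theta>) \<le> \<epsilon> * b"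
        using \<epsilon> by (intro mult_left_mono) auto
      moreover have "(1 - \<epsilon>) * (mean_score P \<theta> \<bullet> \<theta>) \<le> (1 - \<epsilon>) * (- c)"
        using \<theta>0(2)[OF that] \<epsilon>1 by (intro mult_left_mono) (auto simp: c_def)
      ultimately show ?thesis
        using \<epsilon>c by (simp add: mean inner_add_left)
    qed
    then obtain \<theta> where \<theta>: "norm \<theta> \<le> 1" "mean_score ?M \<theta> = 0"
      by (rule exists_zero_of_inward_field[OF continuous_on_subset[OF continuous_on_mean_score[OF M(1,2)] subset_UNIV]])
    have M_eq: "score_equation \<psi> ?M \<eta> \<longleftrightarrow> \<eta> = \<theta>" for \<eta>
      using score_equation_iff[OF M(1,2)] mean_score_inj[OF M, of \<eta> \<theta>] \<theta>(2) by auto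
    have TM: "T_functional \<psi> ?M = \<theta>"
      by (simp add: T_functional_def M_eq)
    have lower: "\<sigma> * (\<epsilon> * sqrt (real CARD('n) - 2) / 12) \<le> norm \<theta>"
    \<comment> \<open>In dimension 2 the claimed bound is 0; the inverse moment estimate covers
      larger dimensions.\<close>
    proof (cases "CARD('n) = 2")
      case False
      with assms(1) have dim: "DIM(real^'n) > 2" by simp
      define s where "s = \<sigma> * sqrt (real CARD('n) - 2)"
      have s: "s > 0" using dim assms(2) by (simp add: s_def)
      have "AE x in P. x \<noteq> 0"
        unfolding assms(3)
        by (rule absolutely_continuous_AE[OF _ absolutely_continuous_isotropic_normal(2)[OF assms(2)]])
          (auto intro: AE_lborel_singleton)
      then have "norm (mean_score P \<theta>) \<le> 2 * b * norm \<theta> * (\<integral>x. 1 / norm x \<partial>P)"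
        by (intro mean_score_lipschitz_at_center P center)
          (use isotropic_normal_inverse_norm(1)[OF assms(2) dim] assms(3) in auto)
      also have "\<dots> \<le> 2 * b * norm \<theta> * (1 / s)"
        using isotropic_normal_inverse_norm(2)[OF assms(2) dim] bound_pos assms(3)
        by (intro mult_left_mono) (auto simp: s_def)
      finally have up: "norm (mean_score P \<theta>) \<le> 2 * b * norm \<theta> * (1 / s)" .
      have mq: "m \<le> norm (q - \<theta>)"
        using norm_triangle_ineq2[of q \<theta>] q \<theta>(1) by linarith
      have "b / 2 \<le> norm (score \<psi> (q - \<theta>))"
        using psi_mono[OF m(1) mq] m(2) by (simp add: norm_score)
      then have "\<epsilon> * (b / 2) \<le> \<epsilon> * norm (score \<psi> (q - \<theta>))"
        using \<epsilon> by (intro mult_left_mono) auto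
      \<comment> \<open>At the zero the two contributions cancel, so their norms agree.\<close>
      also have "\<dots> = (1 - \<epsilon>) * norm (mean_score P \<theta>)"
      proof -
        have "(1 - \<epsilon>) *\<^sub>R mean_score P \<theta> = - (\<epsilon> *\<^sub>R score \<psi> (q - \<theta>))"
          using \<theta>(2) unfolding mean by (simp add: eq_neg_iff_add_eq_0)
        from arg_cong[OF this, of norm] show ?thesis
          using \<epsilon> \<epsilon>1 by simp
      qed
      also have "\<dots> \<le> 1 * norm (mean_score P \<theta>)"
        using \<epsilon> by (intro mult_right_mono) auto
      finally have "\<epsilon> * (b / 2) \<le> 2 * b * norm \<theta> * (1 / s)"
        using up by simp
      then have "b * (\<epsilon> * s) \<le> b * (4 * norm \<theta>)"
        using s by (simp add: field_simps)
      then have "\<epsilon> * s \<le> 4 * norm \<theta>"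
        using bound_pos by simp
      \<comment> \<open>Nonnegativity allows the constant 4 to be relaxed to 12.\<close>
      moreover have "\<epsilon> * s \<ge> 0" using \<epsilon> s by simp
      ultimately show ?thesis by (simp add: s_def algebra_simps)
    qed simp
    show ?thesis
      using P_eq M_eq TP TM lower by simp
  qed
  ultimately show ?thesis
    using Q by blast
qed

end
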